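(* Let $0<q<1$ and let $a$ be a complex number with $|a|<1$. Then $$ \sum_{k=0}^{\infty}\zeta[2k+2]a^{2k}=\sum_{n=1}^{\infty} \frac{q^{3n^2-3n+1}p(n)}% {\genfrac{[}{]}{0pt}{}{2n}{n}_q[n]_q([n]_q^2-a^2q^{2n})([2n]_q^2-a^2q^{4n})} \prod_{m=1}^{n-1}\frac{[m]_q^2-a^2(q^m+1)^2}{[n+m]_q^2-a^2q^{2(n+m)}}, $$ where $$ p(n)=(3q^{4n-1}+6q^{3n-1}-q^{2n}+8q^{2n-1}-4q^n+8q^{n-1}+1)[n]_q^3 -8q^n[n]_q^2 -a^2q^{4n-1}\bigl((3q^{2n}+4q^n-q+3)[n]_q-2\bigr). $$ In particular, $$ \zeta[2]=\sum_{n=1}^{\infty}\frac{q^{3n^2-3n+1}\bigl((3q^{4n-1}+6q^{3n-1}-q^{2n} +8q^{2n-1}-4q^n+8q^{n-1}+1)[n]_q-8q^n\bigr)}{\genfrac{[}{]}{0pt}{}{2n}{n}_q^3\,[n]_q^3}. $$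
   Context: Throughout, $0<q<1$. For a positive integer $n$, $[n]_q=\frac{1-q^n}{1-q}$. The $q$-shifted factorial is $(a;q)_0=1$ and $(a;q)_n=(1-a)(1-aq)\cdots(1-aq^{n-1})$ for $n\ge1$, and the $q$-binomial coefficient is $\genfrac{[}{]}{0pt}{}{n}{k}_q=\frac{(q;q)_n}{(q;q)_k(q;q)_{n-k}}$ for integers $n\ge k\ge 0$. The $q$-analogue of the Riemann zeta function is $\zeta[s]=\sum_{n=1}^{\infty}\frac{q^{n(s-1)}}{[n]_q^s}$.
   Formalization: The term 8q^n subtracted in p(n) (as 8q^n [n]_q^2) and in the formula for ζ[2] is corrected to 8q^{n-1}; as printed both identities fail, e.g. at a=0, q=1/2 the left side is at most 1 while the right side exceeds 1.27. *)

theory Defs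
  imports "HOL-Analysis.Analysis"
begin

definition q_int :: "real \<Rightarrow> nat \<Rightarrow> real" where
  "q_int q n = (1 - q ^ n) / (1 - q)"

definition q_pochhammer :: "real \<Rightarrow> real \<Rightarrow> nat \<Rightarrow> real" where
  "q_pochhammer a q n = (\<Prod>k<n. 1 - a * q ^ k)"

(* Only meant for k \<le> n, since n - k is truncated subtraction. *)
definition q_binomial :: "real \<Rightarrow> nat \<Rightarrow> nat \<Rightarrow> real" where
  "q_binomial q n k =
     q_pochhammer q q n / (q_pochhammer q q k * q_pochhammer q q (n - k))"

(* Library series start at index 0, so the n-th summand (n \<ge> 1) sits at index n - 1. *)
definition q_zeta :: "real \<Rightarrow> complex \<Rightarrow> complex" where
  "q_zeta q s =
     (\<Sum>n. complex_of_real q powr (of_nat (Suc n) * (s - 1))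
            / complex_of_real (q_int q (Suc n)) powr s)"

(* The exponents n - 1, 2n - 1, 3n - 1, 4n - 1 and 3n^2 - 3n + 1 below are natural
   numbers; these definitions are only used for n \<ge> 1, where no subtraction truncates. *)

definition p_coeff :: "real \<Rightarrow> nat \<Rightarrow> real" where
  "p_coeff q n =
     3 * q ^ (4*n - 1) + 6 * q ^ (3*n - 1) - q ^ (2*n) + 8 * q ^ (2*n - 1)
       - 4 * q ^ n + 8 * q ^ (n - 1) + 1"

(* The terms 8 * q ^ (n - 1) subtracted here and in zeta2_term are printed in the source as
   8 q^n, which makes both identities false: at a = 0, as q tends to 0, the left side is
   q + O(q^2), while the first summand on the right would be 9 q + O(q^2). *)
definition p_poly :: "real \<Rightarrow> complex \<Rightarrow> nat \<Rightarrow> complex" where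
  "p_poly q a n =
     complex_of_real (p_coeff q n * q_int q n ^ 3 - 8 * q ^ (n - 1) * q_int q n ^ 2)
       - a ^ 2 * complex_of_real
           (q ^ (4*n - 1) * ((3 * q ^ (2*n) + 4 * q ^ n - q + 3) * q_int q n - 2))"

definition zeta_gf_term :: "real \<Rightarrow> complex \<Rightarrow> nat \<Rightarrow> complex" where
  "zeta_gf_term q a n =
     complex_of_real (q ^ (3*n^2 - 3*n + 1)) * p_poly q a n
       / (complex_of_real (q_binomial q (2*n) n * q_int q n)
          * (complex_of_real (q_int q n ^ 2) - a ^ 2 * complex_of_real (q ^ (2*n)))
          * (complex_of_real (q_int q (2*n) ^ 2) - a ^ 2 * complex_of_real (q ^ (4*n))))
     * (\<Prod>m = 1..n - 1.
          (complex_of_real (q_int q m ^ 2) - a ^ 2 * complex_of_real ((q ^ m + 1) ^ 2))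
          / (complex_of_real (q_int q (n + m) ^ 2) - a ^ 2 * complex_of_real (q ^ (2*(n + m)))))"

definition zeta2_term :: "real \<Rightarrow> nat \<Rightarrow> real" where
  "zeta2_term q n =
     q ^ (3*n^2 - 3*n + 1) * (p_coeff q n * q_int q n - 8 * q ^ (n - 1))
       / (q_binomial q (2*n) n ^ 3 * q_int q n ^ 3)"

end

theory Submission
  imports Defs
begin

text \<open>
  Put \<open>D y = (1 - y)\<^sup>2 - (a (1 - q) y)\<^sup>2\<close>, so that the left-hand side, summed as a geometric series
  in \<open>a\<^sup>2\<close>, is the sum over \<open>k \<ge> 0\<close> of \<open>F 0 k = (1 - q)\<^sup>2 x / D x\<close> with \<open>x = q^(k+1)\<close>. This kernel
  extends to \<open>F n k = c n * x^(2n+1) / (D x * D (x q) * \<dots> * D (x q^n))\<close>. Looking for a companion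
  \<open>G n k = F n k * R n x\<close> with \<open>R n\<close> affine in \<open>x\<close> and
  \<open>F (n+1) k - F n k = G n (k+1) - G n k\<close>, and comparing coefficients of powers of \<open>x\<close>, determines
  both \<open>R n\<close> and the ratio \<open>c (n+1) / c n\<close>. Summing this relation over \<open>k > n\<close> shows that
  \<open>Phi n\<close>, the sum of \<open>F n k\<close> over \<open>k \<ge> n\<close>, satisfies
  \<open>Phi n - Phi (n+1) = F n n + G n (n+1)\<close>. The right-hand side is the term of index \<open>n + 1\<close> of the
  accelerated series, and \<open>Phi n\<close> tends to 0 because of the factor \<open>q^(2n(n+1))\<close>. The formula
  for \<open>\<zeta>[2]\<close> is the case \<open>a = 0\<close>.
\<close>

section \<open>q-factorials, central q-binomials and q-integers\<close>

lemma q_pochhammer_nonzero: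
  assumes "0 < q" "q < 1"
  shows "q_pochhammer q q n \<noteq> 0"
proof -
  have "q * q ^ k \<noteq> 1" for k
    using assms power_Suc_less_one[of q k] by simp
  thus ?thesis by (auto simp: q_pochhammer_def)
qed

lemma q_binomial_nonzero: "0 < q \<Longrightarrow> q < 1 \<Longrightarrow> q_binomial q n k \<noteq> 0"
  by (simp add: q_binomial_def q_pochhammer_nonzero)

text \<open>Passing from n to n+1 contributes (1 - q^(2n+1)) (1 - q^(2n+2)) / (1 - q^(n+1))^2, and 1
  - q^(2n+2) is a difference of squares. The resulting form matches \<open>c_ratio\<close>.\<close>

lemma q_binomial_central_Suc:
  assumes "0 < q" "q < 1"
  shows "q_binomial q (2 * Suc n) (Suc n) =
    q_binomial q (2 * n) n * ((1 - q ^ (2*n+1)) * (1 + q ^ (n+1))) / (1 - q ^ (n+1))"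
proof -
  have pos: "1 - q ^ Suc k \<noteq> 0" for k
    using assms power_Suc_less_one[of q k] by simp
  have S: "q_pochhammer q q (Suc k) = q_pochhammer q q k * (1 - q ^ Suc k)" for k
    by (simp add: q_pochhammer_def)
  have "q_pochhammer q q (2 * Suc n) = q_pochhammer q q (2*n) * (1 - q ^ (2*n+1)) * (1 - q ^ (2*n+2))"
    by (simp add: S)
  moreover have "1 - q ^ (2*n+2) = (1 - q ^ (n+1)) * (1 + q ^ (n+1))"
    by (simp add: algebra_simps flip: power_add mult_2)
  ultimately show ?thesis
    using q_pochhammer_nonzero[OF assms, of n] pos[of n] by (simp add: q_binomial_def S divide_simps)
qed

text \<open>Extended to m = n, the product is the reciprocal of the central q-binomial; the factor m
  = n is then divided out. At a = 0 the product in the accelerated series is the square of this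
  one.\<close>

lemma prod_q_int_quotient:
  assumes "0 < q" "q < 1" "0 < n"
  shows "(\<Prod>m = 1..n - 1. q_int q m / q_int q (n + m)) =
    q_int q (2*n) / (q_int q n * q_binomial q (2*n) n)"
proof -
  have pos: "1 - q ^ k \<noteq> 0" if "k > 0" for k
    using assms that by (simp add: power_less_one_iff less_imp_neq)
  have I: "q_int q k \<noteq> 0" if "k > 0" for k
    using pos[OF that] assms by (simp add: q_int_def)
  have P: "q_pochhammer q q k = (\<Prod>m = 1..k. 1 - q ^ m)" for k
    unfolding q_pochhammer_def
    by (rule prod.reindex_bij_witness[of _ "\<lambda>m. m - 1" Suc]) auto
  note nz = q_pochhammer_nonzero[OF assms(1,2)]
  have "q_pochhammer q q (2*n) = (\<Prod>m = 1..n. 1 - q ^ m) * (\<Prod>m = n+1..n+n. 1 - q ^ m)"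
    unfolding P mult_2 by (rule prod.ub_add_nat) simp
  also have "(\<Prod>m = n+1..n+n. 1 - q ^ m) = (\<Prod>m = 1..n. 1 - q ^ (n + m))"
    using prod.shift_bounds_cl_nat_ivl[of "\<lambda>m. 1 - q ^ m" 1 n n] by (simp add: add.commute)
  finally have "q_pochhammer q q (2*n) = q_pochhammer q q n * (\<Prod>m = 1..n. 1 - q ^ (n + m))"
    by (simp add: P)
  hence B: "q_binomial q (2*n) n = (\<Prod>m = 1..n. 1 - q ^ (n + m)) / (\<Prod>m = 1..n. 1 - q ^ m)"
    using nz[of n] by (simp add: q_binomial_def P[of n] mult_2)
  note nzB = q_binomial_nonzero[OF assms(1,2), of "2*n" n]
  have "(\<Prod>m = 1..n. q_int q m / q_int q (n + m)) = (\<Prod>m = 1..n. (1 - q ^ m) / (1 - q ^ (n + m)))"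
    using assms by (intro prod.cong) (auto simp: q_int_def)
  also have "\<dots> = 1 / q_binomial q (2*n) n"
    unfolding B prod_dividef by simp
  finally have full: "(\<Prod>m = 1..n. q_int q m / q_int q (n + m)) = 1 / q_binomial q (2*n) n" .
  obtain k where k: "n = Suc k"
    using assms(3) gr0_implies_Suc by blast
  have "(\<Prod>m = 1..n. q_int q m / q_int q (n + m)) =
      (\<Prod>m = 1..n - 1. q_int q m / q_int q (n + m)) * (q_int q n / q_int q (2*n))"
    by (simp add: k mult_2)
  hence "(\<Prod>m = 1..n - 1. q_int q m / q_int q (n + m)) * (q_int q n / q_int q (2*n)) =
      1 / q_binomial q (2*n) n"
    using full by simp
  thus ?thesis
    using nzB I[of n] I[of "2*n"] assms by (simp add: field_simps)
qed

section \<open>Zeta values and geometric expansion\<close>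

lemma q_zeta_nat:
  assumes "0 < q"
  shows "q_zeta q (of_nat (Suc s)) =
    (\<Sum>n. complex_of_real (q ^ (Suc n * s)) / complex_of_real (q_int q (Suc n)) ^ Suc s)"
proof -
  have "complex_of_real q powr (of_nat (Suc n) * (of_nat (Suc s) - 1)) = complex_of_real (q ^ (Suc n * s))" for n
  proof -
    have "of_nat (Suc n) * (of_nat (Suc s) - 1) = (of_nat (Suc n * s) :: complex)"
      by (simp add: algebra_simps)
    thus ?thesis using assms by (simp only: powr_nat) simp
  qed
  moreover have "complex_of_real (q_int q (Suc n)) powr of_nat (Suc s) =
      complex_of_real (q_int q (Suc n)) ^ Suc s" for n
    unfolding powr_nat by simp
  ultimately show ?thesis
    by (simp only: q_zeta_def)
qed

text \<open>This expands each \<open>f n\<close> geometrically and exchanges the two summations. The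
  factor \<open>1 - r n\<close> turns each inner sum into \<open>T k - T (Suc k)\<close>, and the
  outer sum telescopes because |T k| is at most \<rho>^k times the sum of |f n|.\<close>

lemma sums_geometric_expansion:
  fixes f r :: "nat \<Rightarrow> 'a::{banach,real_normed_field}"
  assumes f: "summable (\<lambda>n. norm (f n))" and r: "\<And>n. norm (r n) \<le> \<rho>" and \<rho>: "\<rho> < 1"
  shows "(\<lambda>k. \<Sum>n. f n * (1 - r n) * r n ^ k) sums (\<Sum>n. f n)"
proof -
  have \<rho>0: "0 \<le> \<rho>"
    using order_trans[OF norm_ge_zero r] .
  have le: "norm (f n * r n ^ k) \<le> \<rho> ^ k * norm (f n)" for n k
    using mult_right_mono[OF power_mono[OF r[of n] norm_ge_zero, of k], of "norm (f n)"]
    by (simp add: norm_mult norm_power mult.commute)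
  have s: "summable (\<lambda>n. norm (f n * r n ^ k))" for k
    by (rule summable_comparison_test'[OF summable_mult[OF f]]) (use le in simp)
  note s' = summable_norm_cancel[OF s]
  define T where "T k = (\<Sum>n. f n * r n ^ k)" for k
  have T: "(\<Sum>n. f n * (1 - r n) * r n ^ k) = T k - T (Suc k)" for k
    using suminf_diff[OF s'[of k] s'[of "Suc k"]] by (simp add: T_def right_diff_distrib left_diff_distrib mult_ac)
  have le_T: "norm (T k) \<le> \<rho> ^ k * (\<Sum>n. norm (f n))" for k
  proof -
    have "norm (T k) \<le> (\<Sum>n. norm (f n * r n ^ k))"
      unfolding T_def by (rule summable_norm[OF s])
    also have "\<dots> \<le> (\<Sum>n. \<rho> ^ k * norm (f n))"
      by (intro suminf_le le s summable_mult f)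
    also have "\<dots> = \<rho> ^ k * (\<Sum>n. norm (f n))"
      by (rule suminf_mult[OF f])
    finally show ?thesis .
  qed
  have "(\<lambda>k. \<rho> ^ k * (\<Sum>n. norm (f n))) \<longlonglongrightarrow> 0"
    using \<rho>0 \<rho> by (intro tendsto_mult_left_zero LIMSEQ_power_zero) simp
  hence "T \<longlonglongrightarrow> 0"
    by (rule Lim_null_comparison[OF always_eventually[OF allI[OF le_T]]])
  hence "(\<lambda>k. T k - T (Suc k)) sums (T 0 - 0)"
    by (rule telescope_sums')
  moreover have "T 0 - 0 = (\<Sum>n. f n)"
    by (simp add: T_def)
  ultimately show ?thesis
    unfolding T by simp
qed

section \<open>Identities of rational functions\<close>

lemma add_fractions:
  fixes C :: "'a :: field"
  assumes "M \<noteq> 0" "d \<noteq> 0" "e \<noteq> 0" "w \<noteq> 0" "v \<noteq> 0"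
  shows "C / (d * M) + C * E / (M * e) * (u / (w * v)) = C * (w * v * e + E * u * d) / (M * d * e * w * v)"
  using assms by (simp add: field_simps)

text \<open>For u = 1 - q, the five powers of u on the left are distributed over three denominator
  factors, which restores the q-integers there.\<close>

lemma rescale_fractions:
  fixes B :: "'a :: field"
  assumes "M \<noteq> 0" "d \<noteq> 0" "e \<noteq> 0" "w \<noteq> 0" "v \<noteq> 0" "u \<noteq> 0" "B \<noteq> 0"
  shows "(u ^ 2 * y * P / B) * p * u ^ 3 / (M * d * e * w * v) =
    y * p / (B * w * v / u * (d / u ^ 2) * (e / u ^ 2)) * (P / M)"
  using assms by (simp add: field_simps power2_eq_square power3_eq_cube)

text \<open>With t = q, x = q^(k+1), Q = q^(n+1) and E = q^(2n+1), this is the relation between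
  \<open>F\<close> and \<open>G\<close>, divided by \<open>F n k\<close> and cleared of the
  denominator \<open>d (x * Q)\<close>.\<close>

lemma wz_polynomial_identity:
  fixes t Q E x :: "'a :: field"
  assumes "Q ^ 2 = t * E" "1 - E \<noteq> 0" "1 + Q \<noteq> 0"
    and d: "\<And>y. d y = (1 - y) ^ 2 - (b * y) ^ 2"
    and r: "\<And>y. r y = (1 - 2 * E * y / (1 + Q)) / (1 - E)"
  shows "E * (1 - Q) / ((1 - E) * (1 + Q)) * ((1 - Q) ^ 2 - (b * (1 + Q)) ^ 2) * x ^ 2 - d (x * Q) =
    r (t * x) * E * d x - r x * d (x * Q)"
proof -
  define w where "w = (1 - E) * (1 + Q)"
  have w: "w \<noteq> 0" using assms by (simp add: w_def)
  have rx: "r y = (1 + Q - 2 * E * y) / w" for y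
    using assms(2,3) by (simp add: r w_def divide_simps)
  have rt: "r (t * x) = (1 + Q - 2 * Q ^ 2 * x) / w"
    by (simp add: rx assms(1) mult_ac)
  \<comment> \<open>Once t * E = Q^2 has removed t, the identity is polynomial in independent b, x,
    Q, E. The cubic terms in x on the right cancel, which explains the slope chosen in
    \<open>r\<close>.\<close>
  have "E * (1 - Q) * ((1 - Q) ^ 2 - (b * (1 + Q)) ^ 2) * x ^ 2 - d (x * Q) * w =
      (1 + Q - 2 * Q ^ 2 * x) * E * d x - (1 + Q - 2 * E * x) * d (x * Q)"
    unfolding d w_def by algebra
  thus ?thesis
    unfolding rt rx[of x] w_def[symmetric] using w by (simp add: divide_simps)
qed

section \<open>The kernel and its companion\<close>

locale q_zeta_acceleration =
  fixes q :: real and a :: complex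
  assumes q_pos: "0 < q" and q_less_1: "q < 1" and a_less_1: "cmod a < 1"
begin

abbreviation z :: complex where "z \<equiv> complex_of_real q"

definition D :: "complex \<Rightarrow> complex" where
  "D y = (1 - y) ^ 2 - (a * (1 - z) * y) ^ 2"

text \<open>\<open>D (q^m)\<close> and \<open>N m\<close> are \<open>(1 - q)\<^sup>2\<close> times the denominator \<open>[m]\<^sup>2 - a\<^sup>2 q^(2m)\<close> and the
  numerator \<open>[m]\<^sup>2 - a\<^sup>2 (q^m + 1)\<^sup>2\<close>; this scaling makes the relations polynomial in powers of \<open>q\<close>.\<close>
definition N :: "nat \<Rightarrow> complex" where
  "N m = (1 - z ^ m) ^ 2 - (a * (1 - z) * (1 + z ^ m)) ^ 2"

definition c_ratio :: "nat \<Rightarrow> complex" where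
  "c_ratio n = z ^ (2*n+1) * (1 - z ^ (n+1)) / ((1 - z ^ (2*n+1)) * (1 + z ^ (n+1))) * N (n+1)"

definition c :: "nat \<Rightarrow> complex" where
  "c n = (1 - z) ^ 2 * (\<Prod>m<n. c_ratio m)"

definition F :: "nat \<Rightarrow> nat \<Rightarrow> complex" where
  "F n k = c n * z ^ ((k+1) * (2*n+1)) / (\<Prod>j\<le>n. D (z ^ (k+1+j)))"

definition R :: "nat \<Rightarrow> complex \<Rightarrow> complex" where
  "R n x = (1 - 2 * z ^ (2*n+1) * x / (1 + z ^ (n+1))) / (1 - z ^ (2*n+1))"

definition G :: "nat \<Rightarrow> nat \<Rightarrow> complex" where
  "G n k = F n k * R n (z ^ (k+1))"

lemma norm_z [simp]: "cmod z = q"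
  using q_pos by simp

lemma one_minus_z_nonzero [simp]: "1 - z \<noteq> 0"
  using q_less_1 by (simp add: complex_eq_iff)

lemma one_minus_z_power_nonzero: "0 < k \<Longrightarrow> 1 - z ^ k \<noteq> 0"
  using q_pos q_less_1 power_less_one_iff[of q k]
  by (simp add: complex_eq_iff flip: of_real_power)

lemma one_plus_z_power_nonzero: "1 + z ^ k \<noteq> 0"
proof -
  have "complex_of_real (1 + q ^ k) \<noteq> 0"
    unfolding of_real_eq_0_iff using zero_less_power[OF q_pos, of k] by linarith
  thus ?thesis by simp
qed

lemma of_real_q_int: "complex_of_real (q_int q n) = (1 - z ^ n) / (1 - z)"
  by (simp add: q_int_def)

lemma q_int_ge_1: "0 < n \<Longrightarrow> 1 \<le> q_int q n"
  using q_pos q_less_1 power_decreasing[of 1 n q] by (simp add: q_int_def divide_simps)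

lemma D_z_power:
  "D (z ^ n) = (1 - z) ^ 2 * (complex_of_real (q_int q n ^ 2) - a ^ 2 * complex_of_real (q ^ (2*n)))"
proof -
  have "complex_of_real (q ^ (2*n)) = (z ^ n) ^ 2"
    by (simp flip: power_mult add: mult.commute)
  moreover have "(1 - z) ^ 2 * complex_of_real (q_int q n ^ 2) = (1 - z ^ n) ^ 2"
    by (simp add: of_real_q_int del: right_diff_distrib_numeral flip: power_mult_distrib)
  ultimately show ?thesis
    by (simp add: D_def right_diff_distrib[of "(1 - z) ^ 2"] power_mult_distrib mult_ac)
qed

lemma N_eq:
  "N m = (1 - z) ^ 2 * (complex_of_real (q_int q m ^ 2) - a ^ 2 * complex_of_real ((q ^ m + 1) ^ 2))"
proof -
  have "(1 - z) ^ 2 * complex_of_real (q_int q m ^ 2) = (1 - z ^ m) ^ 2"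
    by (simp add: of_real_q_int del: right_diff_distrib_numeral flip: power_mult_distrib)
  thus ?thesis
    by (simp add: N_def right_diff_distrib[of "(1 - z) ^ 2"] power_mult_distrib mult_ac add.commute)
qed

lemma D_z_power_scaled:
  "complex_of_real (q_int q n ^ 2) - a ^ 2 * complex_of_real (q ^ (2*n)) = D (z ^ n) / (1 - z) ^ 2"
  unfolding D_z_power using one_minus_z_nonzero by (simp del: right_minus_eq)

lemma N_scaled:
  "complex_of_real (q_int q m ^ 2) - a ^ 2 * complex_of_real ((q ^ m + 1) ^ 2) = N m / (1 - z) ^ 2"
  unfolding N_eq using one_minus_z_nonzero by (simp del: right_minus_eq)

section \<open>Uniform lower bound for the denominators\<close>

definition \<delta> :: real where "\<delta> = (1 - q) ^ 2 * (1 - cmod a ^ 2)"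

lemma \<delta>_pos: "0 < \<delta>"
  using q_less_1 a_less_1 by (simp add: \<delta>_def power_less_one_iff abs_square_less_1)

lemma norm_a_power_q_int:
  assumes "0 < n"
  shows "cmod (a ^ 2 * complex_of_real (q ^ (2*n))) \<le> cmod a ^ 2 * q_int q n ^ 2"
proof -
  have "q ^ (2*n) \<le> 1"
    using q_pos q_less_1 by (simp add: power_le_one)
  also have "1 \<le> q_int q n ^ 2"
    using q_int_ge_1[OF assms] by (simp add: one_le_power)
  finally show ?thesis
    using q_pos by (simp add: norm_mult norm_power mult_left_mono)
qed

text \<open>For n >= 1, q^(2n) <= 1 <= [n]^2, hence |[n]^2 - a^2 q^(2n)| >= [n]^2 (1 - |a|^2) >= 1 -
  |a|^2.\<close>

lemma norm_D_ge:
  assumes "0 < n"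
  shows "\<delta> \<le> cmod (D (z ^ n))"
proof -
  let ?u = "complex_of_real (q_int q n ^ 2)" and ?v = "a ^ 2 * complex_of_real (q ^ (2*n))"
  have a2: "cmod a ^ 2 \<le> 1"
    using a_less_1 by (simp add: power_le_one)
  have "1 - cmod a ^ 2 \<le> q_int q n ^ 2 * (1 - cmod a ^ 2)"
    using q_int_ge_1[OF assms] a2 mult_right_mono[of 1 "q_int q n ^ 2" "1 - cmod a ^ 2"]
    by (simp add: one_le_power)
  also have "\<dots> \<le> cmod ?u - cmod ?v"
    using norm_a_power_q_int[OF assms] by (simp add: norm_power algebra_simps)
  also have "\<dots> \<le> cmod (?u - ?v)"
    by (rule norm_triangle_ineq2)
  finally have "(1 - q) ^ 2 * (1 - cmod a ^ 2) \<le> (1 - q) ^ 2 * cmod (?u - ?v)"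
    by (intro mult_left_mono) auto
  also have "\<dots> = cmod (D (z ^ n))"
    using q_less_1 unfolding D_z_power norm_mult norm_power
    by (metis norm_of_real of_real_1 of_real_diff power2_abs)
  finally show ?thesis by (simp add: \<delta>_def)
qed

lemma D_nonzero: "0 < n \<Longrightarrow> D (z ^ n) \<noteq> 0"
  using norm_D_ge[of n] \<delta>_pos by force

section \<open>The Wilf-Zeilberger relation\<close>

lemma c_Suc: "c (Suc n) = c n * c_ratio n"
  by (simp add: c_def)

lemma F_Suc: "F (Suc n) k = F n k * (c_ratio n * (z ^ (k+1)) ^ 2 / D (z ^ (k+1) * z ^ (n+1)))"
proof -
  have "z ^ ((k+1) * (2 * Suc n + 1)) = z ^ ((k+1) * (2*n+1)) * (z ^ (k+1)) ^ 2"
    by (simp only: power_mult[symmetric] power_add[symmetric]) (simp add: algebra_simps)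
  moreover have "z ^ (k + 1 + Suc n) = z ^ (k+1) * z ^ (n+1)"
    by (simp add: power_add)
  ultimately show ?thesis
    by (simp only: F_def c_Suc prod.atMost_Suc) simp
qed

text \<open>With x = q^(k+1), the window of denominators moves by one step: \<open>D x\<close>
  leaves it and \<open>D (x * q^(n+1))\<close> enters.\<close>

lemma F_shift:
  "F n (Suc k) = F n k * (z ^ (2*n+1) * D (z ^ (k+1)) / D (z ^ (k+1) * z ^ (n+1)))"
proof -
  define P where "P = (\<Prod>j\<le>n. D (z ^ (k+1+j)))"
  define P' where "P' = (\<Prod>j\<le>n. D (z ^ (Suc k+1+j)))"
  have nz: "P \<noteq> 0" "P' \<noteq> 0"
    unfolding P_def P'_def by (auto simp del: power_Suc simp: D_nonzero)
  have "P * D (z ^ (k+1) * z ^ (n+1)) = (\<Prod>j\<le>Suc n. D (z ^ (k+1+j)))"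
    by (simp add: P_def power_add mult.assoc)
  also have "\<dots> = D (z ^ (k+1)) * P'"
    by (subst prod.atMost_Suc_shift) (simp add: P'_def)
  finally have eq: "P * D (z ^ (k+1) * z ^ (n+1)) = D (z ^ (k+1)) * P'" .
  have nzD: "D (z ^ (k+1) * z ^ (n+1)) \<noteq> 0"
    unfolding power_add[symmetric] by (rule D_nonzero) simp
  have "z ^ ((Suc k+1) * (2*n+1)) = z ^ ((k+1) * (2*n+1)) * z ^ (2*n+1)"
    unfolding power_add[symmetric] by (simp add: algebra_simps)
  hence "F n (Suc k) = c n * z ^ ((k+1) * (2*n+1)) * z ^ (2*n+1) / P'"
    by (simp only: F_def P'_def mult.assoc)
  also have "\<dots> = c n * z ^ ((k+1) * (2*n+1)) / P *
      (z ^ (2*n+1) * D (z ^ (k+1)) / D (z ^ (k+1) * z ^ (n+1)))"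
    using nz nzD eq D_nonzero[of "k+1"] by (simp add: frac_eq_eq mult_ac)
  finally show ?thesis
    by (simp only: F_def P_def)
qed

text \<open>Dividing by \<open>F n k\<close> leaves only the ratios from \<open>F_Suc\<close> and
  \<open>F_shift\<close>, so the claim reduces to \<open>wz_polynomial_identity\<close> with b = a
  (1 - q).\<close>

lemma wz_pair: "F (Suc n) k - F n k = G n (Suc k) - G n k"
proof -
  define x Q E where "x = z ^ (k+1)" and "Q = z ^ (n+1)" and "E = z ^ (2*n+1)"
  have nz: "D (x * Q) \<noteq> 0"
    unfolding x_def Q_def power_add[symmetric] by (rule D_nonzero) simp
  have "c_ratio n * x ^ 2 - D (x * Q) = R n (z * x) * E * D x - R n x * D (x * Q)"
    unfolding c_ratio_def N_def Q_def[symmetric] E_def[symmetric]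
  proof (rule wz_polynomial_identity[where t = z and b = "a * (1 - z)"])
    show "Q ^ 2 = z * E"
      by (simp add: Q_def E_def mult.commute flip: power_mult power_Suc)
    show "1 - E \<noteq> 0" "1 + Q \<noteq> 0"
      using one_minus_z_power_nonzero[of "2*n+1"] one_plus_z_power_nonzero[of "n+1"]
      by (simp_all add: E_def Q_def)
  qed (simp_all add: D_def R_def E_def Q_def)
  hence "c_ratio n * x ^ 2 / D (x * Q) - 1 = E * D x / D (x * Q) * R n (z * x) - R n x"
    using nz by (simp add: divide_simps mult_ac)
  hence "F n k * (c_ratio n * x ^ 2 / D (x * Q) - 1) =
      F n k * (E * D x / D (x * Q) * R n (z * x) - R n x)"
    by simp
  hence "F n k * (c_ratio n * x ^ 2 / D (x * Q)) - F n k =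
      F n k * (E * D x / D (x * Q)) * R n (z * x) - F n k * R n x"
    by (simp only: right_diff_distrib mult_1_right mult.assoc)
  thus ?thesis
    unfolding G_def F_Suc F_shift x_def Q_def E_def by simp
qed

section \<open>Growth estimates and limits\<close>

definition K :: real where "K = 5 / (1 - q)"

lemma norm_one_minus_z_power: "cmod (1 - z ^ k) = 1 - q ^ k"
proof -
  have "cmod (1 - z ^ k) = cmod (complex_of_real (1 - q ^ k))" by simp
  also have "\<dots> = 1 - q ^ k"
    unfolding norm_of_real using q_pos q_less_1 by (simp add: power_le_one)
  finally show ?thesis .
qed

lemma norm_one_plus_z_power: "cmod (1 + z ^ k) = 1 + q ^ k"
proof -
  have "cmod (1 + z ^ k) = cmod (complex_of_real (1 + q ^ k))" by simp
  also have "\<dots> = 1 + q ^ k"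
    unfolding norm_of_real using q_pos zero_le_power[of q k] by linarith
  finally show ?thesis .
qed

text \<open>The 5 in \<open>K\<close> bounds the numerator, since |N m| <= 1 + 2^2 for m >= 1; the
  denominator is at least 1 - q.\<close>

lemma norm_c_ratio_le: "cmod (c_ratio n) \<le> K"
proof -
  have qk: "0 < q ^ k" "q ^ k \<le> 1" for k
    using q_pos q_less_1 by (simp_all add: power_le_one)
  have "cmod (N (n+1)) \<le> cmod (1 - z ^ (n+1)) ^ 2 + cmod (a * (1 - z) * (1 + z ^ (n+1))) ^ 2"
    unfolding N_def norm_power[symmetric] by (rule norm_triangle_ineq4)
  also have "\<dots> \<le> 1 ^ 2 + (1 * 1 * 2) ^ 2"
    unfolding norm_mult norm_one_plus_z_power norm_one_minus_z_power
    using a_less_1 qk[of "n+1"] q_pos q_less_1 norm_one_minus_z_power[of 1]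
    by (intro add_mono power_mono mult_mono) auto
  finally have N: "cmod (N (n+1)) \<le> 5" by simp
  have "q ^ (2*n+1) \<le> q"
    using q_pos q_less_1 power_decreasing[of 1 "2*n+1" q] by simp
  hence "(1 - q) * 1 \<le> (1 - q ^ (2*n+1)) * (1 + q ^ (n+1))"
    using q_pos q_less_1 qk[of "n+1"] qk(2)[of "2*n+1"] by (intro mult_mono) auto
  moreover have "q ^ (2*n+1) * (1 - q ^ (n+1)) * cmod (N (n+1)) \<le> 1 * 1 * 5"
    using qk[of "n+1"] by (intro mult_mono qk(2) N) auto
  ultimately have "q ^ (2*n+1) * (1 - q ^ (n+1)) * cmod (N (n+1)) /
      ((1 - q ^ (2*n+1)) * (1 + q ^ (n+1))) \<le> 5 / (1 - q)"
    using q_less_1 qk by (intro frac_le) auto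
  thus ?thesis
    unfolding c_ratio_def norm_mult norm_divide norm_power norm_z norm_one_minus_z_power
      norm_one_plus_z_power K_def by (simp add: mult_ac)
qed

lemma norm_c_le: "cmod (c n) \<le> K ^ n"
proof (induction n)
  case 0
  show ?case
    using q_pos q_less_1 norm_one_minus_z_power[of 1] by (simp add: c_def norm_power power_le_one)
next
  case (Suc n)
  thus ?case
    using mult_mono[OF Suc norm_c_ratio_le[of n]] q_less_1
    by (simp add: c_Suc norm_mult K_def mult.commute)
qed

lemma norm_F_le: "cmod (F n k) \<le> K ^ n / \<delta> ^ Suc n * q ^ ((k+1) * (2*n+1))"
proof -
  have "\<delta> ^ Suc n = (\<Prod>j\<le>n. \<delta>)" by simp
  also have "\<dots> \<le> (\<Prod>j\<le>n. cmod (D (z ^ (k+1+j))))"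
    using \<delta>_pos by (intro prod_mono) (simp add: norm_D_ge del: power_Suc add_Suc)
  finally have P: "\<delta> ^ Suc n \<le> cmod (\<Prod>j\<le>n. D (z ^ (k+1+j)))"
    by (simp add: prod_norm)
  have "cmod (F n k) = cmod (c n) * q ^ ((k+1) * (2*n+1)) / cmod (\<Prod>j\<le>n. D (z ^ (k+1+j)))"
    by (simp only: F_def norm_mult norm_divide norm_power norm_z)
  also have "\<dots> \<le> K ^ n * q ^ ((k+1) * (2*n+1)) / \<delta> ^ Suc n"
    using P \<delta>_pos q_pos norm_c_le[of n] order_trans[OF norm_ge_zero norm_c_le[of n]]
    by (intro frac_le mult_mono) auto
  finally show ?thesis by simp
qed

lemma norm_F_diagonal_le: "cmod (F n (n + j)) \<le> (K * q ^ n / \<delta>) ^ n / \<delta> * q ^ j"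
proof -
  have "cmod (F n (n + j)) \<le> K ^ n / \<delta> ^ Suc n * q ^ ((n+j+1) * (2*n+1))"
    by (rule norm_F_le)
  \<comment> \<open>Weakening the exponent to n * n + j splits the bound into an n-th power and a
    geometric term in j.\<close>
  also have "\<dots> \<le> K ^ n / \<delta> ^ Suc n * q ^ (n * n + j)"
    using q_pos q_less_1 \<delta>_pos
    by (intro mult_left_mono power_decreasing) (auto simp: K_def algebra_simps)
  also have "\<dots> = (K * q ^ n / \<delta>) ^ n / \<delta> * q ^ j"
    by (simp add: power_add power_mult power_divide power_mult_distrib mult_ac)
  finally show ?thesis .
qed

lemma summable_norm_F: "summable (\<lambda>j. cmod (F n (n + j)))"
proof (rule summable_comparison_test')
  show "summable (\<lambda>j. (K * q ^ n / \<delta>) ^ n / \<delta> * q ^ j)"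
    using q_pos q_less_1 by (intro summable_mult summable_geometric) simp
  show "norm (cmod (F n (n + j))) \<le> (K * q ^ n / \<delta>) ^ n / \<delta> * q ^ j" for j
    using norm_F_diagonal_le by simp
qed

definition Phi :: "nat \<Rightarrow> complex" where "Phi n = (\<Sum>j. F n (n + j))"

lemma Phi_tendsto_0: "Phi \<longlonglongrightarrow> 0"
proof (rule Lim_null_comparison)
  have geo: "summable (\<lambda>j. q ^ j)"
    using q_pos q_less_1 by (intro summable_geometric) simp
  have "cmod (Phi n) \<le> (K * q ^ n / \<delta>) ^ n / \<delta> * (\<Sum>j. q ^ j)" for n
  proof -
    have "cmod (Phi n) \<le> (\<Sum>j. cmod (F n (n + j)))"
      unfolding Phi_def by (rule summable_norm[OF summable_norm_F])
    also have "\<dots> \<le> (\<Sum>j. (K * q ^ n / \<delta>) ^ n / \<delta> * q ^ j)"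
      by (intro suminf_le norm_F_diagonal_le summable_norm_F summable_mult geo)
    also have "\<dots> = (K * q ^ n / \<delta>) ^ n / \<delta> * (\<Sum>j. q ^ j)"
      by (rule suminf_mult[OF geo])
    finally show ?thesis .
  qed
  thus "\<forall>\<^sub>F n in sequentially. cmod (Phi n) \<le> (K * q ^ n / \<delta>) ^ n / \<delta> * (\<Sum>j. q ^ j)"
    by simp
  \<comment> \<open>The factor q^n inside the base outweighs the constants K and \<delta>: once the
    base is below 1/2, its n-th power is at most (1/2)^n.\<close>
  have "(\<lambda>n. K * q ^ n / \<delta>) \<longlonglongrightarrow> K * 0 / \<delta>"
    using q_pos q_less_1 by (intro tendsto_intros LIMSEQ_power_zero) (use \<delta>_pos in auto)
  hence "\<forall>\<^sub>F n in sequentially. K * q ^ n / \<delta> < 1/2"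
    by (rule order_tendstoD) simp
  hence ev: "\<forall>\<^sub>F n in sequentially. norm ((K * q ^ n / \<delta>) ^ n) \<le> (1/2) ^ n"
  proof eventually_elim
    case (elim n)
    have "0 \<le> K * q ^ n / \<delta>"
      using q_pos q_less_1 \<delta>_pos by (simp add: K_def)
    thus ?case
      using elim unfolding norm_power by (intro power_mono) auto
  qed
  have "(\<lambda>n. (K * q ^ n / \<delta>) ^ n) \<longlonglongrightarrow> 0"
    by (rule Lim_null_comparison[OF ev]) (simp add: LIMSEQ_power_zero)
  hence "(\<lambda>n. (K * q ^ n / \<delta>) ^ n / \<delta> * (\<Sum>j. q ^ j)) \<longlonglongrightarrow> 0 / \<delta> * (\<Sum>j. q ^ j)"
    by (intro tendsto_intros) (use \<delta>_pos in auto)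
  thus "(\<lambda>n. (K * q ^ n / \<delta>) ^ n / \<delta> * (\<Sum>j. q ^ j)) \<longlonglongrightarrow> 0"
    by simp
qed

text \<open>\<open>F n k\<close> is summable in k, while \<open>R n x\<close> tends to
  \<open>R n 0\<close> as x = q^(k+1) tends to 0. The telescoping sum thus has no boundary term at
  infinity.\<close>

lemma G_tendsto_0: "(\<lambda>j. G n (n + j)) \<longlonglongrightarrow> 0"
proof -
  have F: "(\<lambda>j. F n (n + j)) \<longlonglongrightarrow> 0"
    using summable_LIMSEQ_zero[OF summable_norm_cancel[OF summable_norm_F]] .
  have "(\<lambda>j. z ^ j) \<longlonglongrightarrow> 0"
    by (intro LIMSEQ_power_zero) (simp add: q_less_1 del: norm_of_real)
  hence "(\<lambda>j. z ^ (j + (n + 1))) \<longlonglongrightarrow> 0"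
    by (rule LIMSEQ_ignore_initial_segment)
  hence "(\<lambda>j. R n (z ^ (j + (n + 1)))) \<longlonglongrightarrow>
      (1 - 2 * z ^ (2*n+1) * 0 / (1 + z ^ (n+1))) / (1 - z ^ (2*n+1))"
    unfolding R_def using one_plus_z_power_nonzero[of "n+1"] one_minus_z_power_nonzero[of "2*n+1"]
    by (intro tendsto_intros) auto
  from tendsto_mult[OF F this] show ?thesis
    by (simp add: G_def add_ac)
qed

section \<open>Telescoping along the diagonal\<close>

lemma Phi_diff: "Phi n - Phi (Suc n) = F n n + G n (Suc n)"
proof -
  have s: "summable (\<lambda>j. F n (n + j))" for n
    by (rule summable_norm_cancel[OF summable_norm_F])
  have lim: "(\<lambda>j. G n (Suc n + j)) \<longlonglongrightarrow> 0"
    using LIMSEQ_Suc[OF G_tendsto_0[of n]] by simp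
  have 1: "(\<lambda>j. F n (Suc n + j) - F (Suc n) (Suc n + j)) sums (G n (Suc n + 0) - 0)"
  proof -
    have "F n (Suc n + j) - F (Suc n) (Suc n + j) = G n (Suc n + j) - G n (Suc n + Suc j)" for j
      using wz_pair[of n "Suc n + j"] by (simp add: algebra_simps)
    thus ?thesis
      using telescope_sums'[OF lim] by simp
  qed
  \<comment> \<open>\<open>Phi n\<close> starts at k = n, but the relation is summed from k = n + 1,
    so \<open>F n n\<close> splits off.\<close>
  have 2: "(\<lambda>j. F n (Suc n + j)) sums (Phi n - F n n)"
    using summable_sums[OF s[of n]] by (simp add: sums_Suc_iff[of "\<lambda>j. F n (n + j)", simplified] Phi_def)
  have 3: "(\<lambda>j. F (Suc n) (Suc n + j)) sums Phi (Suc n)"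
    unfolding Phi_def by (rule summable_sums[OF s])
  show ?thesis
    using sums_unique2[OF 1 sums_diff[OF 2 3]] by (simp add: algebra_simps)
qed

lemma diagonal_sums: "(\<lambda>n. F n n + G n (Suc n)) sums Phi 0"
  using telescope_sums'[OF Phi_tendsto_0] by (simp add: Phi_diff)

section \<open>Closed form of the diagonal terms\<close>

text \<open>The powers q^(2m+1) for m < n multiply to q^(n^2), and the other quotients in
  \<open>c_ratio\<close> are inverse ratios of consecutive central q-binomials.\<close>

lemma c_eq:
  "c n = (1 - z) ^ 2 * z ^ (n ^ 2) * (\<Prod>m = 1..n. N m) / complex_of_real (q_binomial q (2*n) n)"
proof (induction n)
  case 0
  show ?case
    by (simp add: c_def q_binomial_def q_pochhammer_def)
next
  case (Suc n)
  have B: "complex_of_real (q_binomial q (2 * Suc n) (Suc n)) = complex_of_real (q_binomial q (2*n) n) *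
      ((1 - z ^ (2*n+1)) * (1 + z ^ (n+1))) / (1 - z ^ (n+1))"
    unfolding q_binomial_central_Suc[OF q_pos q_less_1] by simp
  have "(Suc n) ^ 2 = n ^ 2 + (2*n+1)"
    by (simp add: power2_eq_square)
  hence "z ^ (Suc n) ^ 2 = z ^ (n ^ 2) * z ^ (2*n+1)"
    by (simp only: power_add)
  thus ?case
    unfolding B c_Suc Suc c_ratio_def by simp
qed

text \<open>The left side is the numerator obtained by adding the two fractions of the diagonal
  term; it is the origin of p. The factor (1 - q)^3 clears the cube of [n+1].\<close>

lemma p_poly_identity:
  fixes n :: nat
  defines "Q \<equiv> z ^ (n+1)" and "E \<equiv> z ^ (2*n+1)"
  shows "(1 - E) * (1 + Q) * D (Q ^ 2) + E * (1 + Q - 2 * Q ^ 3) * D Q = p_poly q a (Suc n) * (1 - z) ^ 3"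
proof -
  define Y where "Y = z ^ n"
  have Q: "Q = z * Y" and E: "E = z * Y ^ 2"
    by (simp_all add: Q_def E_def Y_def mult.commute flip: power_mult)
  have pows: "z ^ (4 * Suc n - 1) = z ^ 3 * Y ^ 4" "z ^ (3 * Suc n - 1) = z ^ 2 * Y ^ 3"
    "z ^ (2 * Suc n) = z ^ 2 * Y ^ 2" "z ^ (2 * Suc n - 1) = z * Y ^ 2"
    "z ^ Suc n = z * Y" "z ^ (Suc n - 1) = Y"
    by (simp_all add: Y_def mult.commute flip: power_mult power_add power_Suc)
  define i where "i = complex_of_real (q_int q (Suc n))"
  have i: "i * (1 - z) = 1 - z * Y"
    using one_minus_z_nonzero by (simp add: i_def of_real_q_int Y_def)
  \<comment> \<open>Distributing v^3 with v = 1 - q pairs every i with a v, so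
    \<open>i * v = 1 - z * Y\<close> eliminates the q-integer.\<close>
  have ring: "(A * i ^ 3 - 8 * Y * i ^ 2 - a ^ 2 * (W * (V * i - 2))) * v ^ 3 =
      A * (i * v) ^ 3 - 8 * Y * v * (i * v) ^ 2 - (a * v) ^ 2 * (W * (V * (i * v) - 2 * v))"
    for A V W v :: complex
    by (simp add: algebra_simps power2_eq_square power3_eq_cube)
  have "p_poly q a (Suc n) =
      (3 * (z ^ 3 * Y ^ 4) + 6 * (z ^ 2 * Y ^ 3) - z ^ 2 * Y ^ 2 + 8 * (z * Y ^ 2) - 4 * (z * Y) + 8 * Y + 1)
        * i ^ 3 - 8 * Y * i ^ 2
      - a ^ 2 * (z ^ 3 * Y ^ 4 * ((3 * (z ^ 2 * Y ^ 2) + 4 * (z * Y) - z + 3) * i - 2))"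
    unfolding p_poly_def p_coeff_def i_def
    by (simp only: of_real_add of_real_diff of_real_mult of_real_power of_real_numeral of_real_1 pows)
  hence "p_poly q a (Suc n) * (1 - z) ^ 3 =
      (3 * (z ^ 3 * Y ^ 4) + 6 * (z ^ 2 * Y ^ 3) - z ^ 2 * Y ^ 2 + 8 * (z * Y ^ 2) - 4 * (z * Y) + 8 * Y + 1)
        * (i * (1 - z)) ^ 3 - 8 * Y * (1 - z) * (i * (1 - z)) ^ 2
      - (a * (1 - z)) ^ 2 * (z ^ 3 * Y ^ 4 *
          ((3 * (z ^ 2 * Y ^ 2) + 4 * (z * Y) - z + 3) * (i * (1 - z)) - 2 * (1 - z)))"
    by (simp only: ring)
  thus ?thesis
    unfolding D_def Q E i by (simp add: algebra_simps power_numeral_reduce)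
qed

lemma diagonal_eq_zeta_gf_term: "F n n + G n (Suc n) = zeta_gf_term q a (Suc n)"
proof -
  define Q E where "Q = z ^ (n+1)" and "E = z ^ (2*n+1)"
  define P where "P = (\<Prod>m = 1..n. N m)"
  define M where "M = (\<Prod>m = 1..n. D (z ^ (n+1+m)))"
  define B where "B = complex_of_real (q_binomial q (2*n) n)"
  define p where "p = p_poly q a (Suc n)"
  have Q2: "Q ^ 2 = z ^ (2 * Suc n)"
    unfolding Q_def power_mult[symmetric] by (simp add: mult.commute)
  have D_nz: "D (z ^ k) \<noteq> 0" if "0 < k" for k
    by (rule D_nonzero[OF that])
  have nz: "1 - Q \<noteq> 0" "1 - E \<noteq> 0" "1 + Q \<noteq> 0" "D Q \<noteq> 0" "D (Q ^ 2) \<noteq> 0" "M \<noteq> 0" "B \<noteq> 0"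
    unfolding Q2 unfolding Q_def E_def M_def B_def of_real_eq_0_iff prod_zero_iff[OF finite_atLeastAtMost]
  proof -
    show "\<not> (\<exists>m\<in>{1..n}. D (z ^ (n+1+m)) = 0)"
      using D_nz by (metis add_gr_0 less_one)
  qed (intro one_minus_z_power_nonzero one_plus_z_power_nonzero D_nz
      q_binomial_nonzero q_pos q_less_1; simp)+
  \<comment> \<open>The denominators at k = n and k = n + 1 share \<open>M\<close>, with exponents
    n+2 to 2n+1. The first has \<open>D Q\<close> in addition, the second
    \<open>D (Q ^ 2)\<close>.\<close>
  have prod0: "(\<Prod>j\<le>n. D (z ^ (n+1+j))) = D Q * M"
    unfolding M_def Q_def atMost_atLeast0 by (subst prod.atLeast_Suc_atMost) simp_all
  have "(\<Prod>j\<le>n. D (z ^ (Suc n+1+j))) = (\<Prod>j<n. D (z ^ (n+1+Suc j))) * D (z ^ (Suc n + 1 + n))"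
    unfolding lessThan_Suc_atMost[symmetric] prod.lessThan_Suc by simp
  also have "\<dots> = M * D (Q ^ 2)"
    unfolding M_def Q2 One_nat_def prod.atLeast1_atMost_eq by (simp add: mult_2)
  finally have prod1: "(\<Prod>j\<le>n. D (z ^ (Suc n+1+j))) = M * D (Q ^ 2)" .
  have "E * z ^ (Suc n+1) = Q ^ 3"
    unfolding E_def Q_def power_mult[symmetric] power_add[symmetric]
    by (rule arg_cong[of _ _ "power z"]) simp
  hence "R n (z ^ (Suc n+1)) = (1 - 2 * Q ^ 3 / (1 + Q)) / (1 - E)"
    unfolding R_def E_def[symmetric] Q_def[symmetric] by (simp only: mult.assoc)
  hence R: "R n (z ^ (Suc n+1)) = (1 + Q - 2 * Q ^ 3) / ((1 - E) * (1 + Q))"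
    using nz by (simp add: divide_simps mult_ac)
  define C where "C = c n * z ^ ((n+1) * (2*n+1))"
  \<comment> \<open>The exponent 3n^2 + 3n + 1 combines n^2 from \<open>c n\<close> with (n+1)(2n+1)
    from x^(2n+1) at x = q^(n+1).\<close>
  have sq: "(Suc n) ^ 2 = n ^ 2 + 2 * n + 1" and "(n+1) * (2*n+1) = 2 * n ^ 2 + 3 * n + 1"
    by (simp_all add: power2_eq_square algebra_simps)
  hence exponent: "3 * (Suc n)^2 - 3 * Suc n + 1 = n ^ 2 + (n+1) * (2*n+1)"
    unfolding sq by simp
  have e: "z ^ (3 * (Suc n)^2 - 3 * Suc n + 1) = z ^ (n ^ 2) * z ^ ((n+1) * (2*n+1))"
    unfolding exponent by (rule power_add)
  have "C = (1 - z) ^ 2 * z ^ (n ^ 2) * P / B * z ^ ((n+1) * (2*n+1))"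
    unfolding C_def c_eq P_def B_def ..
  hence C: "C = (1 - z) ^ 2 * z ^ (3 * (Suc n)^2 - 3 * Suc n + 1) * P / B"
    unfolding e by (metis (no_types, lifting) mult.assoc mult.commute times_divide_eq_left)
  have "z ^ ((Suc n+1) * (2*n+1)) = z ^ ((n+1) * (2*n+1)) * E"
    unfolding E_def power_add[symmetric] by (simp add: algebra_simps)
  hence "F n (Suc n) = C * E / (M * D (Q ^ 2))"
    unfolding F_def prod1 C_def by (simp only: mult.assoc)
  moreover have "F n n = C / (D Q * M)"
    unfolding F_def prod0 C_def ..
  ultimately have "F n n + G n (Suc n) =
      C / (D Q * M) + C * E / (M * D (Q ^ 2)) * ((1 + Q - 2 * Q ^ 3) / ((1 - E) * (1 + Q)))"
    unfolding G_def R by simp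
  also have "\<dots> = C * ((1 - E) * (1 + Q) * D (Q ^ 2) + E * (1 + Q - 2 * Q ^ 3) * D Q) /
      (M * D Q * D (Q ^ 2) * (1 - E) * (1 + Q))"
    by (rule add_fractions) (use nz in auto)
  also have "\<dots> = C * p * (1 - z) ^ 3 / (M * D Q * D (Q ^ 2) * (1 - E) * (1 + Q))"
    using p_poly_identity[of n] by (simp only: Q_def E_def p_def mult.assoc)
  also have "\<dots> = z ^ (3 * (Suc n)^2 - 3 * Suc n + 1) * p /
      (B * (1 - E) * (1 + Q) / (1 - z) * (D Q / (1 - z) ^ 2) * (D (Q ^ 2) / (1 - z) ^ 2)) * (P / M)"
    unfolding C by (rule rescale_fractions) (use nz one_minus_z_nonzero in \<open>simp_all del: right_minus_eq\<close>)
  also have "\<dots> = zeta_gf_term q a (Suc n)"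
  proof -
    have "complex_of_real (q_binomial q (2 * Suc n) (Suc n) * q_int q (Suc n)) = B * (1 - E) * (1 + Q) / (1 - z)"
    proof -
      have "complex_of_real (q_binomial q (2 * Suc n) (Suc n)) = B * ((1 - E) * (1 + Q)) / (1 - Q)"
        unfolding q_binomial_central_Suc[OF q_pos q_less_1] B_def E_def Q_def by simp
      moreover have "complex_of_real (q_int q (Suc n)) = (1 - Q) / (1 - z)"
        unfolding of_real_q_int Q_def by simp
      ultimately show ?thesis
        unfolding of_real_mult using nz(1) by (simp del: right_minus_eq)
    qed
    moreover have "complex_of_real (q_int q (Suc n) ^ 2) - a ^ 2 * complex_of_real (q ^ (2 * Suc n)) = D Q / (1 - z) ^ 2"
      unfolding D_z_power_scaled Q_def by simp
    moreover have "complex_of_real (q_int q (2 * Suc n) ^ 2) - a ^ 2 * complex_of_real (q ^ (4 * Suc n)) =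
        D (Q ^ 2) / (1 - z) ^ 2"
    proof -
      have "4 * Suc n = 2 * (2 * Suc n)" by simp
      thus ?thesis
        unfolding Q2 by (simp only: D_z_power_scaled)
    qed
    moreover have "(\<Prod>m = 1..Suc n - 1.
        (complex_of_real (q_int q m ^ 2) - a ^ 2 * complex_of_real ((q ^ m + 1) ^ 2)) /
        (complex_of_real (q_int q (Suc n + m) ^ 2) - a ^ 2 * complex_of_real (q ^ (2 * (Suc n + m))))) = P / M"
    proof -
      have "x / (1 - z) ^ 2 / (y / (1 - z) ^ 2) = x / y" for x y
        using one_minus_z_nonzero by (simp del: right_minus_eq)
      hence "(complex_of_real (q_int q m ^ 2) - a ^ 2 * complex_of_real ((q ^ m + 1) ^ 2)) /
          (complex_of_real (q_int q (Suc n + m) ^ 2) - a ^ 2 * complex_of_real (q ^ (2 * (Suc n + m)))) =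
          N m / D (z ^ (n+1+m))" for m
        unfolding D_z_power_scaled N_scaled by simp
      thus ?thesis
        by (simp add: P_def M_def prod_dividef)
    qed
    ultimately show ?thesis
      unfolding zeta_gf_term_def p_def by (simp only: of_real_power)
  qed
  finally show ?thesis .
qed

section \<open>Generating function of the zeta values\<close>

text \<open>The geometric ratio is r n = a^2 q^(2(n+1)) / [n+1]^2. Then F 0 n * (1 - r n) is a
  summand of zeta[2], and the factor r n ^ k makes it the summand of zeta[2k+2] times
  a^(2k).\<close>

lemma q_zeta_sums: "(\<lambda>k. q_zeta q (of_nat (2*k + 2)) * a ^ (2*k)) sums Phi 0"
proof -
  define i where "i n = complex_of_real (q_int q (Suc n))" for n
  define r where "r n = a ^ 2 * z ^ (2 * Suc n) / i n ^ 2" for n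
  have i: "i n \<noteq> 0" for n
    using q_int_ge_1[of "Suc n"] by (simp add: i_def)
  have r: "cmod (r n) \<le> cmod a ^ 2" for n
  proof -
    have "cmod (r n) = cmod (a ^ 2 * complex_of_real (q ^ (2 * Suc n))) / q_int q (Suc n) ^ 2"
      by (simp add: r_def i_def norm_divide norm_mult norm_power)
    thus ?thesis
      using norm_a_power_q_int[of "Suc n"] q_int_ge_1[of "Suc n"] by (simp add: divide_le_eq)
  qed
  have a2: "cmod a ^ 2 < 1"
    using a_less_1 by (simp add: abs_square_less_1)
  have F0: "F 0 n * (1 - r n) = z ^ Suc n / i n ^ 2" for n
  proof -
    define X where "X = i n ^ 2 - a ^ 2 * z ^ (2 * Suc n)"
    have DX: "D (z ^ Suc n) = (1 - z) ^ 2 * X"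
      unfolding D_z_power X_def i_def by simp
    hence "X \<noteq> 0"
      using D_nonzero[of "Suc n"] by (simp del: power_Suc)
    moreover have "F 0 n = (1 - z) ^ 2 * z ^ Suc n / D (z ^ Suc n)"
      by (simp add: F_def c_def)
    moreover have "1 - r n = X / i n ^ 2"
      using i[of n] by (simp add: r_def X_def diff_divide_distrib)
    ultimately show ?thesis
      using one_minus_z_nonzero by (simp add: DX del: power_Suc)
  qed
  have "(\<Sum>n. F 0 n * (1 - r n) * r n ^ k) = q_zeta q (of_nat (2*k + 2)) * a ^ (2*k)" for k
  proof -
    have "F 0 n * (1 - r n) * r n ^ k =
        complex_of_real (q ^ (Suc n * Suc (2*k))) / i n ^ Suc (Suc (2*k)) * a ^ (2*k)" for n
    proof -
      have "z ^ (Suc n * Suc (2*k)) = z ^ Suc n * (z ^ (2 * Suc n)) ^ k"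
        unfolding power_mult[symmetric] power_add[symmetric] by (simp add: algebra_simps)
      moreover have "i n ^ Suc (Suc (2*k)) = i n ^ 2 * (i n ^ 2) ^ k"
        by (simp only: power_mult[symmetric] power_add[symmetric]) simp
      moreover have "a ^ (2*k) = (a ^ 2) ^ k"
        by (rule power_mult)
      ultimately show ?thesis
        unfolding F0 by (simp add: r_def power_divide power_mult_distrib mult_ac del: power_Suc)
    qed
    moreover have "summable (\<lambda>n. complex_of_real (q ^ (Suc n * Suc (2*k))) / i n ^ Suc (Suc (2*k)))"
    proof (rule summable_comparison_test')
      show "summable (\<lambda>n. q ^ n)"
        using q_pos q_less_1 by (intro summable_geometric) simp
      fix n :: nat
      have "q ^ (Suc n * Suc (2*k)) / q_int q (Suc n) ^ Suc (Suc (2*k)) \<le> q ^ n / 1"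
        using q_pos q_less_1 q_int_ge_1[of "Suc n"]
        by (intro frac_le power_decreasing one_le_power) auto
      thus "cmod (complex_of_real (q ^ (Suc n * Suc (2*k))) / i n ^ Suc (Suc (2*k))) \<le> q ^ n"
        using q_pos q_int_ge_1[of "Suc n"] by (simp add: i_def norm_divide norm_power norm_mult)
    qed
    ultimately show ?thesis
      using q_zeta_nat[OF q_pos, of "Suc (2*k)"] by (simp add: i_def suminf_mult2)
  qed
  thus ?thesis
    using sums_geometric_expansion[of "F 0" r, OF _ r a2] summable_norm_F[of 0]
    by (simp add: Phi_def)
qed

lemma zeta_gf_sums: "(\<lambda>n. zeta_gf_term q a (Suc n)) sums Phi 0"
  using diagonal_sums by (simp add: diagonal_eq_zeta_gf_term)

end

section \<open>The case a = 0 and the conclusion\<close>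

lemma zeta2_term_eq:
  assumes "0 < q" "q < 1"
  shows "complex_of_real (zeta2_term q (Suc n)) = zeta_gf_term q 0 (Suc n)"
proof -
  define B I J where "B = q_binomial q (2 * Suc n) (Suc n)" and "I = q_int q (Suc n)"
    and "J = q_int q (2 * Suc n)"
  have nz: "B \<noteq> 0" "I \<noteq> 0" "J \<noteq> 0"
    using assms power_Suc_less_one[of q n] power_Suc_less_one[of q "Suc (2*n)"]
    by (auto simp: B_def I_def J_def q_int_def q_binomial_nonzero)
  define e where "e = q ^ (3 * (Suc n)^2 - 3 * Suc n + 1)"
  have "zeta_gf_term q 0 (Suc n) = complex_of_real
      (e * (p_coeff q (Suc n) * I ^ 3 - 8 * q ^ n * I ^ 2) / (B * I * I ^ 2 * J ^ 2) *
       (\<Prod>m = 1..Suc n - 1. q_int q m / q_int q (Suc n + m)) ^ 2)"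
    unfolding zeta_gf_term_def p_poly_def B_def I_def J_def e_def
    by (simp add: prod_power_distrib power_divide)
  also have "(\<Prod>m = 1..Suc n - 1. q_int q m / q_int q (Suc n + m)) = J / (I * B)"
    unfolding B_def I_def J_def by (rule prod_q_int_quotient[OF assms]) simp
  \<comment> \<open>The squared product cancels [2n+2]^2 and supplies two of the three q-binomial
    factors.\<close>
  also have "e * (p_coeff q (Suc n) * I ^ 3 - 8 * q ^ n * I ^ 2) / (B * I * I ^ 2 * J ^ 2) *
      (J / (I * B)) ^ 2 = e * (p_coeff q (Suc n) * I - 8 * q ^ n) / (B ^ 3 * I ^ 3)"
    using nz by (simp add: field_simps power2_eq_square power3_eq_cube)
  also have "\<dots> = zeta2_term q (Suc n)"
    by (simp add: zeta2_term_def e_def B_def I_def)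
  finally show ?thesis ..
qed

theorem theorem2:
  fixes q :: real and a :: complex
  assumes "0 < q" and "q < 1" and "cmod a < 1"
  shows "summable (\<lambda>k. q_zeta q (of_nat (2*k + 2)) * a ^ (2*k))
    \<and> summable (\<lambda>n. zeta_gf_term q a (Suc n))
    \<and> (\<Sum>k. q_zeta q (of_nat (2*k + 2)) * a ^ (2*k)) = (\<Sum>n. zeta_gf_term q a (Suc n))
    \<and> (\<lambda>n. complex_of_real (zeta2_term q (Suc n))) sums q_zeta q 2"
proof -
  interpret acc: q_zeta_acceleration q a
    by unfold_locales (use assms in auto)
  interpret acc0: q_zeta_acceleration q 0
    by unfold_locales (use assms in auto)
  \<comment> \<open>At a = 0 only the summand k = 0 survives, with 0^0 = 1.\<close>
  have "(\<lambda>k. q_zeta q (of_nat (2*k + 2)) * 0 ^ (2*k)) sums q_zeta q 2"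
    using powser_sums_zero[of "\<lambda>k. q_zeta q (of_nat (2*k + 2))"] by (simp add: power_mult)
  hence "acc0.Phi 0 = q_zeta q 2"
    by (rule sums_unique2[OF acc0.q_zeta_sums])
  hence "(\<lambda>n. complex_of_real (zeta2_term q (Suc n))) sums q_zeta q 2"
    using acc0.zeta_gf_sums zeta2_term_eq[OF assms(1,2)] by simp
  thus ?thesis
    using acc.q_zeta_sums acc.zeta_gf_sums by (auto simp: sums_iff)
qed

end
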